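(* Suppose $(R,\mathfrak{m})$ is a local ring, and $M = \bigoplus_{k \in \mathscr{K}} M_k$ is a direct sum of cyclic nonzero $R$-modules, with $|\mathscr{K}| \geq 2$. Then $\sigma(M) = |\mathbb{Z}|$ if $R/\mathfrak{m}$ and $\mathscr{K}$ are both infinite; otherwise $\sigma(M) = \nu'(R,M) = |R/\mathfrak{m}|+1$ as cardinal numbers.
   Context: All rings are unital and commutative; a local ring $(R,\mathfrak{m})$ is one with a unique maximal ideal $\mathfrak{m}$ (not assumed Noetherian). The covering number $\sigma(M)$ of an $R$-module $M$ is the smallest cardinal $\aleph$ (possibly infinite) such that $M$ is a union of $\aleph$-many proper $R$-submodules (the stated equalities include the assertion that such a covering exists). For a ring $R$ and $R$-module $M$, let $S$ be the set of maximal ideals $\mathfrak{n}$ of $R$ with $\dim_{R/\mathfrak{n}} M/\mathfrak{n}M \geq 2$, and, when $S$ is nonempty, let $\nu'(R,M)$ be the minimum over $\mathfrak{n}\in S$ of the cardinal $|R/\mathfrak{n}|+1$. The index set $\mathscr{K}$ may be finite or infinite. *)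

theory Defs
  imports
    "HOL-Algebra.QuotRing"
    "HOL-Algebra.Generated_Groups"
    "Jordan_Normal_Form.Missing_VectorSpace"
begin

unbundle cardinal_syntax

text \<open>
  The constant \<open>submodule\<close> is the one of \<open>LinearCombinations\<close> (AFP entry \<open>VectorSpace\<close>), with
  argument order \<open>submodule R N M\<close>; it hides the one of \<open>HOL-Algebra.Module\<close>.
\<close>

definition local_ring :: "('a, 'r) ring_scheme \<Rightarrow> 'a set \<Rightarrow> bool" where
  "local_ring R \<mm> \<longleftrightarrow> cring R \<and> maximalideal \<mm> R \<and> (\<forall>\<nn>. maximalideal \<nn> R \<longrightarrow> \<nn> = \<mm>)"

definition cyclic_submodule ::
    "('a, 'r) ring_scheme \<Rightarrow> ('a, 'b, 'm) module_scheme \<Rightarrow> 'b set \<Rightarrow> bool" where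
  "cyclic_submodule R M N \<longleftrightarrow>
     submodule R N M \<and> (\<exists>x\<in>carrier M. N = {a \<odot>\<^bsub>M\<^esub> x | a. a \<in> carrier R})"

text \<open>
  \<open>M\<close> is the (internal) direct sum of the submodules \<open>N k\<close>: the canonical map from the external
  direct sum, i.e. from the finitely supported families, to \<open>M\<close> is bijective.
\<close>

definition is_direct_sum ::
    "('a, 'r) ring_scheme \<Rightarrow> ('a, 'b, 'm) module_scheme \<Rightarrow> 'k set \<Rightarrow> ('k \<Rightarrow> 'b set) \<Rightarrow> bool" where
  "is_direct_sum R M K N \<longleftrightarrow>
     (\<forall>k\<in>K. submodule R (N k) M) \<and>
     bij_betw (\<lambda>x. \<Oplus>\<^bsub>M\<^esub>k\<in>{k \<in> K. x k \<noteq> \<zero>\<^bsub>M\<^esub>}. x k)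
       {x \<in> (\<Pi>\<^sub>E k\<in>K. N k). finite {k \<in> K. x k \<noteq> \<zero>\<^bsub>M\<^esub>}} (carrier M)"

text \<open>
  \<open>I M\<close>, the finite sums of products \<open>a x\<close> with \<open>a \<in> I\<close>, \<open>x \<in> M\<close>. For an ideal \<open>I\<close> the set of
  these products is closed under scalar multiplication, so the additive subgroup that it
  generates is already a submodule.
\<close>

definition ideal_smult :: "('a, 'b, 'm) module_scheme \<Rightarrow> 'a set \<Rightarrow> 'b set" where
  "ideal_smult M I = generate (add_monoid M) {a \<odot>\<^bsub>M\<^esub> x | a x. a \<in> I \<and> x \<in> carrier M}"

text \<open>
  \<open>M / I M\<close> as a module over \<open>R Quot I\<close>, with scalar multiplication defined on cosets in the same
  way as \<^const>\<open>rcoset_mult\<close>. The record fields \<open>mult\<close> and \<open>one\<close> play no role for modules.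
\<close>

definition quot_module :: "('a, 'b, 'm) module_scheme \<Rightarrow> 'a set \<Rightarrow> ('a set, 'b set) module" where
  "quot_module M I =
     \<lparr>carrier = a_rcosets\<^bsub>M\<^esub> (ideal_smult M I), mult = undefined, one = undefined,
      zero = ideal_smult M I, add = set_add M,
      smult = (\<lambda>A D. \<Union>a\<in>A. \<Union>x\<in>D. ideal_smult M I +>\<^bsub>M\<^esub> (a \<odot>\<^bsub>M\<^esub> x))\<rparr>"

text \<open>
  The dimension as a cardinal; \<open>vectorspace.dim\<close> is a natural number and only meaningful in the
  finite-dimensional case.
\<close>

definition vdim :: "('f, 'r) ring_scheme \<Rightarrow> ('f, 'v, 'm) module_scheme \<Rightarrow> 'v rel" where
  "vdim F V = |SOME B. vectorspace.basis F V B|"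

text \<open>Only meaningful for a nonempty set of cardinals, where the minimum exists and is unique up
  to \<open>=o\<close>.\<close>

definition min_card :: "'i rel set \<Rightarrow> 'i rel" where
  "min_card A = (SOME r. r \<in> A \<and> (\<forall>s\<in>A. r \<le>o s))"

definition proper_cover ::
    "('a, 'r) ring_scheme \<Rightarrow> ('a, 'b, 'm) module_scheme \<Rightarrow> 'b set set \<Rightarrow> bool" where
  "proper_cover R M C \<longleftrightarrow> (\<forall>N\<in>C. submodule R N M \<and> N \<noteq> carrier M) \<and> \<Union>C = carrier M"

definition covering_number ::
    "('a, 'r) ring_scheme \<Rightarrow> ('a, 'b, 'm) module_scheme \<Rightarrow> 'b set rel"  (\<open>\<sigma>\<close>) where
  "\<sigma> R M = min_card {|C| | C. proper_cover R M C}"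

definition max_ideals_dim_ge2 ::
    "('a, 'r) ring_scheme \<Rightarrow> ('a, 'b, 'm) module_scheme \<Rightarrow> 'a set set" where
  "max_ideals_dim_ge2 R M = {\<nn>. maximalideal \<nn> R \<and> ctwo \<le>o vdim (R Quot \<nn>) (quot_module M \<nn>)}"

definition nu' :: "('a, 'r) ring_scheme \<Rightarrow> ('a, 'b, 'm) module_scheme \<Rightarrow> ('a set + unit) rel"  (\<open>\<nu>''\<close>)
  where "\<nu>' R M = min_card {|carrier (R Quot \<nn>)| +c cone | \<nn>. \<nn> \<in> max_ideals_dim_ge2 R M}"

end

theory Submission
  imports
    "HOL-Algebra.Ring_Divisibility"
    "HOL-Library.Nat_Bijection"
    Defs
begin

text \<open>
  Let \<open>k = R / \<mm>\<close> be the residue field. Every nonzero cyclic module \<open>R e\<close> maps onto \<open>k\<close> by sending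
  \<open>a e\<close> to the residue class of \<open>a\<close>: two coefficients of the same element differ by an element that
  annihilates \<open>e\<close>, and this is not a unit. Hence a direct sum of such modules has a residue
  coordinate \<open>M \<rightarrow> k\<close> for every index, and these coordinates are dual to the generators.

  \<^bold>\<open>Upper bounds.\<close> Two coordinates map \<open>M\<close> onto the plane \<open>k\<^sup>2\<close>, which is the union of its
  \<open>|k| + 1\<close> lines through the origin (\<open>proper_cover_by_lines\<close>). If there are infinitely many
  coordinates, \<open>M\<close> is also an increasing union of a sequence of proper submodules, because every
  element has only finitely many nonzero coordinates (\<open>countable_proper_cover\<close>).

  \<^bold>\<open>Lower bounds.\<close> Two points \<open>x + a v\<close> and \<open>x + b v\<close> of a line whose parameters have distinct residues
  cannot lie in the same submodule unless it contains \<open>v\<close>, since \<open>a - b\<close> is a unit. Thus a line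
  covered by submodules avoiding its direction \<open>v\<close> requires at least \<open>|k|\<close> of them
  (\<open>card_le_of_pencil_covered\<close>). Applied to a minimal subcover, this shows that a finite proper cover
  has at least \<open>|k| + 1\<close> members (\<open>finite_proper_cover_card\<close>); in particular there is none
  if \<open>k\<close> is infinite. For finitely generated \<open>M\<close> an induction on the generators shows that a proper
  cover, finite or not, has at least \<open>|k|\<close> members (\<open>avoid_small_family\<close>), and \<open>|k| = |k| + 1\<close> for
  infinite \<open>k\<close>.

  If \<open>k\<close> and the index set are both infinite, these bounds give \<open>|\<int>|\<close>, and otherwise they give \<open>|k| + 1\<close>.
  Finally \<open>\<mm>\<close> is the only maximal ideal, and the cosets of the generators form a basis of \<open>M / \<mm> M\<close>
  (\<open>basis_coset_e\<close>), so \<open>\<nu>' R M = |k| + 1\<close> as well.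
\<close>

section \<open>Units in local rings\<close>

text \<open>
  Zorn's lemma: \<open>\<one> \<notin> J\<close> expresses properness elementwise, so it passes to unions of chains.
\<close>

lemma (in cring) proper_ideal_subset_maximalideal:
  assumes "ideal I R" and "I \<noteq> carrier R"
  shows "\<exists>J. maximalideal J R \<and> I \<subseteq> J"
proof -
  define \<A> where "\<A> = {J. ideal J R \<and> \<one> \<notin> J \<and> I \<subseteq> J}"
  have proper: "\<one> \<notin> J \<longleftrightarrow> J \<noteq> carrier R" if "ideal J R" for J
    using that ideal.one_imp_carrier by fastforce
  have "\<exists>J\<in>\<A>. \<forall>X\<in>\<A>. J \<subseteq> X \<longrightarrow> X = J"
  proof (rule subset_Zorn_nonempty)
    show "\<A> \<noteq> {}"
      using assms proper by (auto simp: \<A>_def)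
    show "\<Union>\<C> \<in> \<A>" if \<C>: "\<C> \<noteq> {}" "subset.chain \<A> \<C>" for \<C>
    proof -
      have "subset.chain {J. ideal J R} \<C>"
        using \<C>(2) by (auto simp: subset_chain_def \<A>_def)
      from chain_Union_is_ideal[OF this] have "ideal (\<Union>\<C>) R"
        using \<C>(1) by simp
      then show ?thesis
        using \<C> by (auto simp: subset_chain_def \<A>_def)
    qed
  qed
  then obtain J where J: "J \<in> \<A>" and max: "\<And>X. X \<in> \<A> \<Longrightarrow> J \<subseteq> X \<Longrightarrow> X = J"
    by blast
  have "maximalideal J R"
  proof (rule maximalidealI)
    show "ideal J R" "carrier R \<noteq> J"
      using J by (auto simp: \<A>_def)
    show "X = J \<or> X = carrier R" if "ideal X R" "J \<subseteq> X" for X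
      using that J max[of X] proper[of X] by (auto simp: \<A>_def)
  qed
  then show ?thesis
    using J by (auto simp: \<A>_def)
qed

text \<open>
  A non-unit generates a proper principal ideal, and every proper ideal lies in the only maximal
  ideal.
\<close>

lemma (in cring) local_ring_Units:
  assumes "local_ring R \<mm>" and "a \<in> carrier R" and "a \<notin> \<mm>"
  shows "a \<in> Units R"
proof (rule ccontr)
  assume "a \<notin> Units R"
  have "ideal (PIdl a) R"
    using assms(2) by (rule cgenideal_ideal)
  moreover have "PIdl a \<noteq> carrier R"
  proof
    assume "PIdl a = carrier R"
    then have "\<one> \<in> PIdl a" by simp
    then obtain b where "b \<in> carrier R" "\<one> = b \<otimes> a"
      by (auto simp: cgenideal_def)
    then show False
      using \<open>a \<notin> Units R\<close> assms(2) by (auto simp: Units_def m_comm)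
  qed
  ultimately obtain J where "maximalideal J R" "PIdl a \<subseteq> J"
    using proper_ideal_subset_maximalideal by blast
  then show False
    using assms cgenideal_self[OF assms(2)] by (auto simp: local_ring_def)
qed

section \<open>Submodules\<close>

context Module.module
begin

lemma submoduleI:
  assumes "N \<subseteq> carrier M" and "\<zero>\<^bsub>M\<^esub> \<in> N"
    and "\<And>x y. x \<in> N \<Longrightarrow> y \<in> N \<Longrightarrow> x \<oplus>\<^bsub>M\<^esub> y \<in> N"
    and "\<And>a x. a \<in> carrier R \<Longrightarrow> x \<in> N \<Longrightarrow> a \<odot>\<^bsub>M\<^esub> x \<in> N"
  shows "submodule R N M"
  using assms module_axioms by (auto simp: submodule_def)

lemma submodule_minus_closed:
  assumes "submodule R N M" and "x \<in> N" and "y \<in> N"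
  shows "x \<ominus>\<^bsub>M\<^esub> y \<in> N"
proof -
  interpret N: submodule R N M by fact
  have "x \<in> carrier M" "y \<in> carrier M"
    using assms N.subset by auto
  moreover have "\<ominus> \<one> \<odot>\<^bsub>M\<^esub> y \<in> N"
    using assms(3) by simp
  ultimately show ?thesis
    using assms(2) by (simp add: smult_l_minus M.minus_eq)
qed

lemma submodule_finsum_closed:
  assumes "submodule R N M" and "\<And>i. i \<in> A \<Longrightarrow> f i \<in> N"
  shows "finsum M f A \<in> N"
proof -
  interpret N: submodule R N M by fact
  show ?thesis
    using assms(2)
  proof (induction A rule: infinite_finite_induct)
    case (insert x A)
    have "f \<in> A \<rightarrow> carrier M" "f x \<in> carrier M"
      using insert.prems N.subset by auto
    then show ?case
      using insert by simp
  qed simp_all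
qed

lemma add_smult_notin_submodule:
  assumes "submodule R N M" and "v \<in> N" and "a \<in> carrier R"
    and "x \<in> carrier M" and "x \<notin> N"
  shows "x \<oplus>\<^bsub>M\<^esub> a \<odot>\<^bsub>M\<^esub> v \<notin> N"
proof
  interpret N: submodule R N M by fact
  assume "x \<oplus>\<^bsub>M\<^esub> a \<odot>\<^bsub>M\<^esub> v \<in> N"
  then have "(x \<oplus>\<^bsub>M\<^esub> a \<odot>\<^bsub>M\<^esub> v) \<ominus>\<^bsub>M\<^esub> a \<odot>\<^bsub>M\<^esub> v \<in> N"
    using assms(2,3) by (intro submodule_minus_closed N.submodule_axioms) auto
  moreover have "v \<in> carrier M"
    using assms(2) N.subset by blast
  ultimately show False
    using assms(3-5) by (simp add: M.minus_eq M.add.m_assoc M.r_neg)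
qed

lemma unit_smult_mem_submodule_iff:
  assumes "submodule R N M" and "u \<in> Units R" and "x \<in> carrier M"
  shows "u \<odot>\<^bsub>M\<^esub> x \<in> N \<longleftrightarrow> x \<in> N"
proof
  interpret N: submodule R N M by fact
  have u: "u \<in> carrier R" "inv u \<in> carrier R"
    using assms(2) by auto
  show "u \<odot>\<^bsub>M\<^esub> x \<in> N" if "x \<in> N"
    using u that by simp
  assume "u \<odot>\<^bsub>M\<^esub> x \<in> N"
  then have "inv u \<odot>\<^bsub>M\<^esub> (u \<odot>\<^bsub>M\<^esub> x) \<in> N"
    using u by simp
  then show "x \<in> N"
    using u assms by (simp flip: smult_assoc1)
qed

end

section \<open>Modules over a local ring and their residue field\<close>

locale local_module = Module.module R M for R (structure) and M (structure) +
  fixes \<mm>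
  assumes local: "local_ring R \<mm>"
begin

abbreviation F where "F \<equiv> R Quot \<mm>"

sublocale mm: maximalideal \<mm> R
  using local by (simp add: local_ring_def)

sublocale F: field F
  by (rule mm.quotient_is_field) (rule R.is_cring)

sublocale residue: ring_hom_cring R F "(+>) \<mm>"
  by (rule mm.rcos_ring_hom_cring) (rule R.is_cring)

lemma residue_eq_iff:
  assumes "a \<in> carrier R" and "b \<in> carrier R"
  shows "\<mm> +> a = \<mm> +> b \<longleftrightarrow> a \<ominus> b \<in> \<mm>"
  using assms quotient_eq_iff_same_a_r_cos[OF mm.is_ideal, of a b] by simp

lemma residue_surj:
  assumes "t \<in> carrier F"
  obtains a where "a \<in> carrier R" "t = \<mm> +> a"
proof -
  have "carrier F = (\<Union>a\<in>carrier R. {\<mm> +> a})"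
    by (simp only: FactRing_def A_RCOSETS_def' partial_object.simps)
  then show ?thesis
    using assms that by blast
qed

lemma residue_neq_imp_unit:
  assumes "a \<in> carrier R" and "b \<in> carrier R" and "\<mm> +> a \<noteq> \<mm> +> b"
  shows "a \<ominus> b \<in> Units R"
  using assms by (intro local_ring_Units[OF local]) (auto simp: residue_eq_iff)

lemma zero_residue_field: "\<zero>\<^bsub>F\<^esub> = \<mm>"
  by (simp only: FactRing_def ring.simps)

lemma residue_of_mem: "a \<in> \<mm> \<Longrightarrow> \<mm> +> a = \<zero>\<^bsub>F\<^esub>"
  unfolding zero_residue_field by (rule R.a_rcos_zero[OF mm.is_ideal])

section \<open>Lower bounds for covers\<close>

text \<open>
  The points \<open>x \<oplus> a \<odot> v\<close> form an affine line in the direction \<open>v\<close>. Two of its points in \<open>N\<close> with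
  distinct residues would differ by a unit multiple of \<open>v\<close>, which would put \<open>v\<close> into \<open>N\<close>.
\<close>

lemma pencil_meets_submodule_once:
  assumes N: "submodule R N M" and v: "v \<in> carrier M" "v \<notin> N" and x: "x \<in> carrier M"
    and a: "a \<in> carrier R" "x \<oplus>\<^bsub>M\<^esub> a \<odot>\<^bsub>M\<^esub> v \<in> N"
    and b: "b \<in> carrier R" "x \<oplus>\<^bsub>M\<^esub> b \<odot>\<^bsub>M\<^esub> v \<in> N"
  shows "\<mm> +> a = \<mm> +> b"
proof (rule ccontr)
  assume "\<mm> +> a \<noteq> \<mm> +> b"
  then have unit: "a \<ominus> b \<in> Units R"
    by (rule residue_neq_imp_unit[OF a(1) b(1)])
  have "(x \<oplus>\<^bsub>M\<^esub> a \<odot>\<^bsub>M\<^esub> v) \<ominus>\<^bsub>M\<^esub> (x \<oplus>\<^bsub>M\<^esub> b \<odot>\<^bsub>M\<^esub> v) = a \<odot>\<^bsub>M\<^esub> v \<ominus>\<^bsub>M\<^esub> b \<odot>\<^bsub>M\<^esub> v"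
    using a(1) b(1) v(1) x
    by (simp add: M.minus_eq M.minus_add M.add.m_ac M.r_neg1 M.r_neg2)
  also have "\<dots> = (a \<ominus> b) \<odot>\<^bsub>M\<^esub> v"
    using a(1) b(1) v(1) by (simp add: M.minus_eq R.minus_eq smult_l_distr smult_l_minus)
  finally have "(a \<ominus> b) \<odot>\<^bsub>M\<^esub> v \<in> N"
    using submodule_minus_closed[OF N a(2) b(2)] by simp
  then show False
    using unit_smult_mem_submodule_iff[OF N unit v(1)] v(2) by simp
qed

text \<open>
  Both lower bounds below rest on this count: a line that is covered by submodules avoiding its
  direction meets each of them in at most one residue class of parameters.
\<close>

lemma card_le_of_pencil_covered:
  assumes C: "\<And>N. N \<in> C \<Longrightarrow> submodule R N M" and v: "v \<in> carrier M" "v \<notin> \<Union>C"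
    and x: "x \<in> carrier M" and cover: "\<And>a. a \<in> carrier R \<Longrightarrow> x \<oplus>\<^bsub>M\<^esub> a \<odot>\<^bsub>M\<^esub> v \<in> \<Union>C"
  shows "|carrier F| \<le>o |C|"
proof -
  have "\<exists>N\<in>C. \<exists>a\<in>carrier R. t = \<mm> +> a \<and> x \<oplus>\<^bsub>M\<^esub> a \<odot>\<^bsub>M\<^esub> v \<in> N" if t: "t \<in> carrier F" for t
  proof -
    obtain a where "a \<in> carrier R" "t = \<mm> +> a"
      by (rule residue_surj[OF t])
    then show ?thesis
      using cover[of a] by blast
  qed
  then obtain h where h: "\<And>t. t \<in> carrier F \<Longrightarrow>
      h t \<in> C \<and> (\<exists>a\<in>carrier R. t = \<mm> +> a \<and> x \<oplus>\<^bsub>M\<^esub> a \<odot>\<^bsub>M\<^esub> v \<in> h t)"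
    by metis
  have "inj_on h (carrier F)"
  proof (rule inj_onI)
    fix s t assume st: "s \<in> carrier F" "t \<in> carrier F" "h s = h t"
    obtain a where a: "a \<in> carrier R" "s = \<mm> +> a" "x \<oplus>\<^bsub>M\<^esub> a \<odot>\<^bsub>M\<^esub> v \<in> h s"
      using h[OF st(1)] by blast
    obtain b where b: "b \<in> carrier R" "t = \<mm> +> b" "x \<oplus>\<^bsub>M\<^esub> b \<odot>\<^bsub>M\<^esub> v \<in> h s"
      using h[OF st(2)] st(3) by auto
    have "h s \<in> C" using h[OF st(1)] by blast
    then have "\<mm> +> a = \<mm> +> b"
      using pencil_meets_submodule_once[OF C v(1) _ x a(1,3) b(1,3)] v(2) by blast
    then show "s = t"
      using a(2) b(2) by simp
  qed
  moreover have "h ` carrier F \<subseteq> C"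
    using h by blast
  ultimately show ?thesis
    by (meson card_of_ordLeqI image_subset_iff)
qed

text \<open>
  In a minimal subcover, some member \<open>N\<close> has a point \<open>v\<close> that no other member contains. A line in
  the direction \<open>v\<close> through a point outside \<open>N\<close> never meets \<open>N\<close>, so the other members cover it, and
  there are at least \<open>|R / \<mm>|\<close> of them; \<open>N\<close> is one more. Minimal subcovers need finiteness.
\<close>

lemma finite_proper_cover_card:
  assumes "proper_cover R M C" and "finite C"
  shows "|carrier F| +c cone \<le>o |C|"
proof -
  define \<S> where "\<S> = {D. D \<subseteq> C \<and> proper_cover R M D}"
  have "finite \<S>" "C \<in> \<S>"
    using assms by (auto simp: \<S>_def)
  then obtain D where "D \<in> \<S>" and minimal: "\<forall>D'\<in>\<S>. D' \<subseteq> D \<longrightarrow> D = D'"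
    using finite_has_minimal2[of \<S> C] by blast
  then have D: "D \<subseteq> C" "proper_cover R M D"
    by (auto simp: \<S>_def)
  have sub: "\<And>N. N \<in> D \<Longrightarrow> submodule R N M" and proper: "\<And>N. N \<in> D \<Longrightarrow> N \<noteq> carrier M"
    and union: "\<Union>D = carrier M"
    using D(2) by (auto simp: proper_cover_def)
  obtain N where N: "N \<in> D"
    using union M.zero_closed by blast
  have "\<not> proper_cover R M (D - {N})"
    using minimal[rule_format, of "D - {N}"] D(1) N by (auto simp: \<S>_def)
  then have "\<Union>(D - {N}) \<noteq> carrier M"
    using D(2) by (auto simp: proper_cover_def)
  then obtain v where v: "v \<in> carrier M" "v \<notin> \<Union>(D - {N})"
    using union by blast
  then have "v \<in> N"
    using union by blast
  interpret N: submodule R N M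
    using N by (rule sub)
  obtain x where x: "x \<in> carrier M" "x \<notin> N"
    using proper[OF N] N.subset by blast
  have "x \<oplus>\<^bsub>M\<^esub> a \<odot>\<^bsub>M\<^esub> v \<in> \<Union>(D - {N})" if a: "a \<in> carrier R" for a
  proof -
    have "x \<oplus>\<^bsub>M\<^esub> a \<odot>\<^bsub>M\<^esub> v \<notin> N"
      using add_smult_notin_submodule[OF N.submodule_axioms \<open>v \<in> N\<close> a x] .
    moreover have "x \<oplus>\<^bsub>M\<^esub> a \<odot>\<^bsub>M\<^esub> v \<in> \<Union>D"
      using a x(1) v(1) by (simp add: union)
    ultimately show ?thesis by blast
  qed
  then have "|carrier F| \<le>o |D - {N}|"
    using card_le_of_pencil_covered[OF _ v x(1)] sub by blast
  moreover have "cone \<le>o |{N}|"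
    by (simp add: cone_def card_of_singl_ordLeq)
  ultimately have "|carrier F| +c cone \<le>o |D - {N}| +c |{N}|"
    by (rule csum_mono)
  also have "|D - {N}| +c |{N}| =o |Sum_Type.Plus (D - {N}) {N}|"
    by (rule ordIso_symmetric[OF Plus_csum])
  also have "|Sum_Type.Plus (D - {N}) {N}| \<le>o |C|"
    using D(1) N by (intro card_of_ordLeqI[of "case_sum id id"]) (auto simp: inj_on_def)
  finally show ?thesis .
qed

text \<open>
  For finitely generated modules this bounds infinite covers from below, where minimal subcovers
  may fail to exist. Adding a generator \<open>x\<close> to \<open>X\<close>, the induction hypothesis gives a vector \<open>v\<close> in
  the span of \<open>X\<close> that avoids the members not containing \<open>X\<close>. The line \<open>x \<oplus> a \<odot> v\<close> avoids all
  members containing \<open>X\<close>, since they contain \<open>v\<close> but not \<open>x\<close>, and there are too few other members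
  to cover it.
\<close>

lemma avoid_small_family:
  assumes "finite X" and "X \<subseteq> carrier M"
    and "\<And>N. N \<in> C \<Longrightarrow> submodule R N M" and "\<And>N. N \<in> C \<Longrightarrow> \<not> X \<subseteq> N"
    and "|C| <o |carrier F|"
  shows "\<exists>v \<in> span X. v \<notin> \<Union>C"
  using assms
proof (induction X arbitrary: C rule: finite_induct)
  case empty
  then have "C = {}" by blast
  then show ?case
    using submodule.zero_closed[OF span_is_submodule[of "{}"]] by auto
next
  case (insert x X)
  define C1 where "C1 = {N \<in> C. \<not> X \<subseteq> N}"
  have "C1 \<subseteq> C"
    by (auto simp: C1_def)
  then have C1: "|C1| <o |carrier F|"
    using insert.prems(4) card_of_mono1 ordLeq_ordLess_trans by blast
  have "\<exists>v \<in> span X. v \<notin> \<Union>C1"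
  proof (rule insert.IH[OF _ _ _ C1])
    show "X \<subseteq> carrier M"
      using insert.prems(1) by simp
    show "submodule R N M" "\<not> X \<subseteq> N" if "N \<in> C1" for N
      using that insert.prems(2)[of N] by (simp_all add: C1_def)
  qed
  then obtain v where v: "v \<in> span X" "v \<notin> \<Union>C1"
    by blast
  have carr: "x \<in> carrier M" "v \<in> carrier M"
    using insert.prems(1) v(1) span_is_subset2[of X] by auto
  have "\<not> |carrier F| \<le>o |C1|"
    using C1 by (simp add: not_ordLess_ordLeq)
  then obtain a where a: "a \<in> carrier R" and avoid: "x \<oplus>\<^bsub>M\<^esub> a \<odot>\<^bsub>M\<^esub> v \<notin> \<Union>C1"
    using card_le_of_pencil_covered[OF _ carr(2) v(2) carr(1)] \<open>C1 \<subseteq> C\<close> insert.prems(2)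
    by (metis subsetD)
  have "x \<oplus>\<^bsub>M\<^esub> a \<odot>\<^bsub>M\<^esub> v \<notin> N" if N: "N \<in> C" for N
  proof (cases "N \<in> C1")
    case False
    then have "X \<subseteq> N" "x \<notin> N"
      using N insert.prems(3)[OF N] by (auto simp: C1_def)
    interpret N: submodule R N M
      using N by (rule insert.prems)
    have "v \<in> N"
      using span_is_subset[OF \<open>X \<subseteq> N\<close> N.submodule_axioms] v(1) by blast
    show ?thesis
      using add_smult_notin_submodule[OF N.submodule_axioms \<open>v \<in> N\<close> a carr(1) \<open>x \<notin> N\<close>] .
  qed (use avoid in blast)
  moreover have "x \<oplus>\<^bsub>M\<^esub> a \<odot>\<^bsub>M\<^esub> v \<in> span (insert x X)"
  proof -
    interpret S: submodule R "span (insert x X)" M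
      using insert.prems(1) by (rule span_is_submodule)
    have "x \<in> span (insert x X)" "v \<in> span (insert x X)"
      using in_own_span[OF insert.prems(1)] span_is_monotone[of X "insert x X"] v(1) by auto
    then show ?thesis
      using a by simp
  qed
  ultimately show ?case by blast
qed

end

section \<open>Minimal cardinals\<close>

lemma min_card_ordIso:
  assumes "s \<in> A" and "s \<le>o r"
    and "\<And>t. t \<in> A \<Longrightarrow> Card_order t" and "\<And>t. t \<in> A \<Longrightarrow> r \<le>o t"
  shows "min_card A =o r"
proof -
  have "\<exists>m. m \<in> A \<and> (\<forall>t\<in>A. m \<le>o t)"
    using exists_minim_Card_order[of A] assms(1,3) by blast
  then have min: "min_card A \<in> A \<and> (\<forall>t\<in>A. min_card A \<le>o t)"
    unfolding min_card_def by (rule someI_ex)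
  then have "min_card A \<le>o r"
    using assms(1,2) ordLeq_transitive by blast
  then show ?thesis
    using min assms(4) by (simp add: ordIso_iff_ordLeq)
qed

lemma covering_number_ordIso:
  assumes "proper_cover R M C" and "|C| \<le>o r"
    and "\<And>D. proper_cover R M D \<Longrightarrow> r \<le>o |D|"
  shows "\<sigma> R M =o r"
  unfolding covering_number_def
  using assms by (intro min_card_ordIso[of "|C|"]) (auto simp: card_of_Card_order)

section \<open>Functionals to the residue field and covers from them\<close>

context local_module
begin

text \<open>
  The \<open>R\<close>-linear maps from \<open>M\<close> to the residue field, on which \<open>R\<close> acts through its cosets.
\<close>

definition residue_functional :: "('c \<Rightarrow> 'a set) \<Rightarrow> bool" where
  "residue_functional f \<longleftrightarrow> f \<in> carrier M \<rightarrow> carrier F \<and>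
     (\<forall>x\<in>carrier M. \<forall>y\<in>carrier M. f (x \<oplus>\<^bsub>M\<^esub> y) = f x \<oplus>\<^bsub>F\<^esub> f y) \<and>
     (\<forall>a\<in>carrier R. \<forall>x\<in>carrier M. f (a \<odot>\<^bsub>M\<^esub> x) = (\<mm> +> a) \<otimes>\<^bsub>F\<^esub> f x)"

lemma
  assumes "residue_functional f"
  shows residue_functional_closed: "x \<in> carrier M \<Longrightarrow> f x \<in> carrier F"
    and residue_functional_add:
      "x \<in> carrier M \<Longrightarrow> y \<in> carrier M \<Longrightarrow> f (x \<oplus>\<^bsub>M\<^esub> y) = f x \<oplus>\<^bsub>F\<^esub> f y"
    and residue_functional_smult:
      "a \<in> carrier R \<Longrightarrow> x \<in> carrier M \<Longrightarrow> f (a \<odot>\<^bsub>M\<^esub> x) = (\<mm> +> a) \<otimes>\<^bsub>F\<^esub> f x"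
  using assms unfolding residue_functional_def by blast+

lemma residue_functional_zero:
  assumes "residue_functional f"
  shows "f \<zero>\<^bsub>M\<^esub> = \<zero>\<^bsub>F\<^esub>"
proof -
  have "f (\<zero> \<odot>\<^bsub>M\<^esub> \<zero>\<^bsub>M\<^esub>) = (\<mm> +> \<zero>) \<otimes>\<^bsub>F\<^esub> f \<zero>\<^bsub>M\<^esub>"
    by (rule residue_functional_smult[OF assms R.zero_closed M.zero_closed])
  moreover have "\<mm> +> \<zero> = \<zero>\<^bsub>F\<^esub>"
    by (rule residue_of_mem) simp
  ultimately show ?thesis
    using residue_functional_closed[OF assms M.zero_closed] by simp
qed

lemma residue_functional_kernel:
  assumes f: "residue_functional f"
  shows "submodule R {x \<in> carrier M. f x = \<zero>\<^bsub>F\<^esub>} M"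
proof (rule submoduleI)
  show "\<zero>\<^bsub>M\<^esub> \<in> {x \<in> carrier M. f x = \<zero>\<^bsub>F\<^esub>}"
    using residue_functional_zero[OF f] by simp
  show "x \<oplus>\<^bsub>M\<^esub> y \<in> {x \<in> carrier M. f x = \<zero>\<^bsub>F\<^esub>}"
    if "x \<in> {x \<in> carrier M. f x = \<zero>\<^bsub>F\<^esub>}" "y \<in> {x \<in> carrier M. f x = \<zero>\<^bsub>F\<^esub>}" for x y
    using that by (simp add: residue_functional_add[OF f])
  show "a \<odot>\<^bsub>M\<^esub> x \<in> {x \<in> carrier M. f x = \<zero>\<^bsub>F\<^esub>}"
    if "a \<in> carrier R" "x \<in> {x \<in> carrier M. f x = \<zero>\<^bsub>F\<^esub>}" for a x
    using that residue.hom_closed[OF that(1)] by (simp add: residue_functional_smult[OF f])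
qed blast

lemma residue_functional_minus_smult:
  assumes f: "residue_functional f" and g: "residue_functional g" and t: "t \<in> carrier F"
  shows "residue_functional (\<lambda>x. g x \<ominus>\<^bsub>F\<^esub> t \<otimes>\<^bsub>F\<^esub> f x)"
  unfolding residue_functional_def
proof (intro conjI ballI Pi_I)
  note closed = residue_functional_closed[OF f] residue_functional_closed[OF g]
  show "g x \<ominus>\<^bsub>F\<^esub> t \<otimes>\<^bsub>F\<^esub> f x \<in> carrier F" if "x \<in> carrier M" for x
    using closed[OF that] t by simp
  show "g (x \<oplus>\<^bsub>M\<^esub> y) \<ominus>\<^bsub>F\<^esub> t \<otimes>\<^bsub>F\<^esub> f (x \<oplus>\<^bsub>M\<^esub> y)
      = (g x \<ominus>\<^bsub>F\<^esub> t \<otimes>\<^bsub>F\<^esub> f x) \<oplus>\<^bsub>F\<^esub> (g y \<ominus>\<^bsub>F\<^esub> t \<otimes>\<^bsub>F\<^esub> f y)"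
    if "x \<in> carrier M" "y \<in> carrier M" for x y
    unfolding residue_functional_add[OF f that] residue_functional_add[OF g that]
    using closed[OF that(1)] closed[OF that(2)] t by algebra
  show "g (a \<odot>\<^bsub>M\<^esub> x) \<ominus>\<^bsub>F\<^esub> t \<otimes>\<^bsub>F\<^esub> f (a \<odot>\<^bsub>M\<^esub> x)
      = (\<mm> +> a) \<otimes>\<^bsub>F\<^esub> (g x \<ominus>\<^bsub>F\<^esub> t \<otimes>\<^bsub>F\<^esub> f x)"
    if "a \<in> carrier R" "x \<in> carrier M" for a x
    unfolding residue_functional_smult[OF f that] residue_functional_smult[OF g that]
    using closed[OF that(2)] residue.hom_closed[OF that(1)] t by algebra
qed

text \<open>
  The pair \<open>(f, g)\<close> maps \<open>M\<close> to the plane over the residue field, and the plane is the union of its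
  lines through the origin: the line \<open>f = 0\<close> and the lines \<open>g = t f\<close>. Their preimages are proper because
  \<open>x\<close> is not on the first line and \<open>y\<close> is on none of the others.
\<close>

lemma proper_cover_by_lines:
  assumes f: "residue_functional f" and g: "residue_functional g"
    and x: "x \<in> carrier M" "f x \<noteq> \<zero>\<^bsub>F\<^esub>"
    and y: "y \<in> carrier M" "f y = \<zero>\<^bsub>F\<^esub>" "g y \<noteq> \<zero>\<^bsub>F\<^esub>"
  obtains C where "proper_cover R M C" and "|C| \<le>o |carrier F| +c cone"
proof -
  define H where "H t = {z \<in> carrier M. g z \<ominus>\<^bsub>F\<^esub> t \<otimes>\<^bsub>F\<^esub> f z = \<zero>\<^bsub>F\<^esub>}" for t
  define L where "L = {z \<in> carrier M. f z = \<zero>\<^bsub>F\<^esub>}"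
  define C where "C = case_sum H (\<lambda>_. L) ` Sum_Type.Plus (carrier F) {()}"
  have C: "N \<in> C \<longleftrightarrow> (\<exists>t\<in>carrier F. N = H t) \<or> N = L" for N
    by (auto simp: C_def Plus_def image_Un image_image)
  have "submodule R (H t) M" if "t \<in> carrier F" for t
    unfolding H_def by (intro residue_functional_kernel residue_functional_minus_smult f g that)
  moreover have "submodule R L M"
    unfolding L_def by (intro residue_functional_kernel f)
  moreover have "H t \<noteq> carrier M" if "t \<in> carrier F" for t
  proof -
    have "y \<notin> H t"
      using y that residue_functional_closed[OF g y(1)] by (simp add: H_def F.minus_eq)
    then show ?thesis
      using y(1) by blast
  qed
  moreover have "L \<noteq> carrier M"
    using x by (auto simp: L_def)
  moreover have "\<Union>C = carrier M"
  proof
    show "\<Union>C \<subseteq> carrier M"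
      by (auto simp: C H_def L_def)
    show "carrier M \<subseteq> \<Union>C"
    proof
      fix z assume z: "z \<in> carrier M"
      note fz = residue_functional_closed[OF f z] and gz = residue_functional_closed[OF g z]
      show "z \<in> \<Union>C"
      proof (cases "f z = \<zero>\<^bsub>F\<^esub>")
        case True
        then have "z \<in> L"
          using z by (simp add: L_def)
        then show ?thesis
          using C[of L] by blast
      next
        case False
        then have unit: "f z \<in> Units F"
          using fz by (simp add: F.field_Units)
        define t where "t = g z \<otimes>\<^bsub>F\<^esub> inv\<^bsub>F\<^esub> f z"
        have t: "t \<in> carrier F"
          using gz unit by (simp add: t_def)
        have "t \<otimes>\<^bsub>F\<^esub> f z = g z"
          using fz gz unit by (simp add: t_def F.m_assoc)
        then have "z \<in> H t"
          using z gz by (simp add: H_def F.minus_eq F.r_neg)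
        then show ?thesis
          using t C[of "H t"] by blast
      qed
    qed
  qed
  ultimately have "proper_cover R M C"
    unfolding proper_cover_def by (metis C)
  moreover have "|C| \<le>o |carrier F| +c cone"
    unfolding C_def cone_def by (rule ordLeq_ordIso_trans[OF card_of_image Plus_csum])
  ultimately show ?thesis
    by (rule that)
qed

text \<open>
  The submodules on which \<open>f i\<close> vanishes for all \<open>i \<ge> n\<close> increase with \<open>n\<close> and exhaust \<open>M\<close>.
\<close>

lemma countable_proper_cover:
  fixes f :: "nat \<Rightarrow> 'c \<Rightarrow> 'a set"
  assumes f: "\<And>n. residue_functional (f n)"
    and nontrivial: "\<And>n. \<exists>x\<in>carrier M. f n x \<noteq> \<zero>\<^bsub>F\<^esub>"
    and fin: "\<And>x. x \<in> carrier M \<Longrightarrow> finite {n. f n x \<noteq> \<zero>\<^bsub>F\<^esub>}"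
  obtains C where "proper_cover R M C" and "|C| \<le>o |UNIV :: nat set|"
proof -
  define P where "P n = {x \<in> carrier M. \<forall>i\<ge>n. f i x = \<zero>\<^bsub>F\<^esub>}" for n
  have kernel: "submodule R {x \<in> carrier M. f i x = \<zero>\<^bsub>F\<^esub>} M" for i
    by (rule residue_functional_kernel[OF f])
  have "submodule R (P n) M" for n
  proof (rule submoduleI)
    show "\<zero>\<^bsub>M\<^esub> \<in> P n"
      using submodule.zero_closed[OF kernel] by (simp add: P_def)
    show "x \<oplus>\<^bsub>M\<^esub> y \<in> P n" if "x \<in> P n" "y \<in> P n" for x y
      using that submodule.m_closed[OF kernel, of x _ y] by (simp add: P_def)
    show "a \<odot>\<^bsub>M\<^esub> x \<in> P n" if "a \<in> carrier R" "x \<in> P n" for a x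
      using that submodule.smult_closed[OF kernel, of a x] by (simp add: P_def)
  qed (auto simp: P_def)
  moreover have "P n \<noteq> carrier M" for n
    using nontrivial[of n] by (auto simp: P_def)
  moreover have "\<Union>(range P) = carrier M"
  proof
    show "carrier M \<subseteq> \<Union>(range P)"
    proof
      fix x assume x: "x \<in> carrier M"
      then obtain n where "{n. f n x \<noteq> \<zero>\<^bsub>F\<^esub>} \<subseteq> {..<n}"
        using fin finite_nat_iff_bounded by blast
      then have "x \<in> P n"
        using x by (force simp: P_def)
      then show "x \<in> \<Union>(range P)"
        by blast
    qed
  qed (auto simp: P_def)
  ultimately have "proper_cover R M (range P)"
    by (auto simp: proper_cover_def)
  then show ?thesis
    using card_of_image by (rule that)
qed

end

section \<open>The quotient of a module by an ideal\<close>

context Module.module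
begin

lemma ideal_smult_generators_subset:
  assumes "ideal I R"
  shows "{a \<odot>\<^bsub>M\<^esub> x | a x. a \<in> I \<and> x \<in> carrier M} \<subseteq> carrier M"
  using ideal.Icarr[OF assms] by auto

lemma submodule_ideal_smult:
  assumes "ideal I R"
  shows "submodule R (ideal_smult M I) M"
proof (rule submoduleI)
  let ?S = "{a \<odot>\<^bsub>M\<^esub> x | a x. a \<in> I \<and> x \<in> carrier M}"
  interpret I: ideal I R by fact
  have S: "?S \<subseteq> carrier M"
    by (rule ideal_smult_generators_subset[OF assms])
  show sub: "ideal_smult M I \<subseteq> carrier M"
    using M.add.generate_incl[of ?S] S by (simp add: ideal_smult_def)
  show "\<zero>\<^bsub>M\<^esub> \<in> ideal_smult M I"
    using generate.one[of "add_monoid M" ?S] by (simp add: ideal_smult_def)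
  show add: "x \<oplus>\<^bsub>M\<^esub> y \<in> ideal_smult M I"
    if "x \<in> ideal_smult M I" "y \<in> ideal_smult M I" for x y
    using generate.eng[of x "add_monoid M" ?S y] that by (simp add: ideal_smult_def)
  fix c x assume c: "c \<in> carrier R" and "x \<in> ideal_smult M I"
  from this(2) have "x \<in> generate (add_monoid M) ?S"
    by (simp add: ideal_smult_def)
  then show "c \<odot>\<^bsub>M\<^esub> x \<in> ideal_smult M I"
  proof (induction x rule: generate.induct)
    case one
    then show ?case
      using c generate.one[of "add_monoid M" ?S] by (simp add: ideal_smult_def)
  next
    case (incl h)
    then obtain a x where h: "h = a \<odot>\<^bsub>M\<^esub> x" "a \<in> I" "x \<in> carrier M"
      by blast
    have "c \<odot>\<^bsub>M\<^esub> h = (c \<otimes> a) \<odot>\<^bsub>M\<^esub> x"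
      using h c by (simp add: smult_assoc1)
    moreover have "c \<otimes> a \<in> I"
      using h(2) c by (rule I.I_l_closed)
    ultimately have "c \<odot>\<^bsub>M\<^esub> h \<in> ?S"
      using h(3) by blast
    then show ?case
      unfolding ideal_smult_def by (rule generate.incl)
  next
    case (inv h)
    then obtain a x where h: "h = a \<odot>\<^bsub>M\<^esub> x" "a \<in> I" "x \<in> carrier M"
      by blast
    have "c \<odot>\<^bsub>M\<^esub> inv\<^bsub>add_monoid M\<^esub> h = c \<odot>\<^bsub>M\<^esub> (\<ominus>\<^bsub>M\<^esub> (a \<odot>\<^bsub>M\<^esub> x))"
      by (simp add: h a_inv_def)
    also have "\<dots> = (c \<otimes> (\<ominus> a)) \<odot>\<^bsub>M\<^esub> x"
      using h c by (simp add: smult_assoc1 smult_l_minus)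
    moreover have "c \<otimes> (\<ominus> a) \<in> I"
      using h(2) c by (simp add: I.I_l_closed)
    ultimately have "c \<odot>\<^bsub>M\<^esub> inv\<^bsub>add_monoid M\<^esub> h \<in> ?S"
      using h(3) by auto
    then show ?case
      unfolding ideal_smult_def by (rule generate.incl)
  next
    case (eng h1 h2)
    have "h1 \<in> carrier M" "h2 \<in> carrier M"
      using eng.hyps M.add.generate_incl[of ?S] S by auto
    then show ?case
      using eng.IH c add by (simp add: smult_r_distr)
  qed
qed

lemma ideal_smult_mem:
  assumes "a \<in> I" and "x \<in> carrier M"
  shows "a \<odot>\<^bsub>M\<^esub> x \<in> ideal_smult M I"
  unfolding ideal_smult_def by (rule generate.incl) (use assms in blast)

lemma ideal_smult_subset_submodule:
  assumes N: "submodule R N M"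
    and sub: "\<And>a x. a \<in> I \<Longrightarrow> x \<in> carrier M \<Longrightarrow> a \<odot>\<^bsub>M\<^esub> x \<in> N"
  shows "ideal_smult M I \<subseteq> N"
proof
  interpret N: submodule R N M by fact
  fix x assume "x \<in> ideal_smult M I"
  then have "x \<in> generate (add_monoid M) {a \<odot>\<^bsub>M\<^esub> x | a x. a \<in> I \<and> x \<in> carrier M}"
    by (simp add: ideal_smult_def)
  then show "x \<in> N"
  proof (induction x rule: generate.induct)
    case (inv h)
    then have "h \<in> N"
      using sub by blast
    then have "\<zero>\<^bsub>M\<^esub> \<ominus>\<^bsub>M\<^esub> h \<in> N" "h \<in> carrier M"
      using submodule_minus_closed[OF N N.zero_closed] N.subset by auto
    then show ?case
      by (simp add: M.minus_eq a_inv_def)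
  qed (use sub in auto)
qed

lemma abelian_subgroup_submodule:
  assumes "submodule R N M"
  shows "abelian_subgroup N M"
proof (rule abelian_subgroupI3)
  interpret N: submodule R N M by fact
  show "additive_subgroup N M"
  proof (rule additive_subgroup.intro, rule M.add.subgroupI)
    show "N \<subseteq> carrier M"
      by (rule N.subset)
    show "N \<noteq> {}"
      using N.zero_closed by blast
    show "\<ominus>\<^bsub>M\<^esub> x \<in> N" if "x \<in> N" for x
    proof -
      have "x \<in> carrier M"
        using that N.subset by blast
      then show ?thesis
        using submodule_minus_closed[OF assms N.zero_closed that] by (simp add: M.minus_eq)
    qed
    show "x \<oplus>\<^bsub>M\<^esub> y \<in> N" if "x \<in> N" "y \<in> N" for x y
      using that by (rule N.m_closed)
  qed
qed (rule M.abelian_group_axioms)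

end

locale module_modulo_ideal = Module.module R M for R (structure) and M (structure) +
  fixes I
  assumes ideal: "ideal I R"
begin

abbreviation IM where "IM \<equiv> ideal_smult M I"

abbreviation V where "V \<equiv> quot_module M I"

sublocale I: ideal I R
  by (rule ideal)

sublocale IM: submodule R IM M
  by (rule submodule_ideal_smult[OF ideal])

sublocale IM: abelian_subgroup IM M
  by (rule abelian_subgroup_submodule[OF IM.submodule_axioms])

lemma carrier_quot_module: "carrier V = (\<lambda>x. IM +>\<^bsub>M\<^esub> x) ` carrier M"
  by (auto simp: quot_module_def A_RCOSETS_def')

lemma add_quot_module:
  assumes "x \<in> carrier M" and "y \<in> carrier M"
  shows "(IM +>\<^bsub>M\<^esub> x) \<oplus>\<^bsub>V\<^esub> (IM +>\<^bsub>M\<^esub> y) = IM +>\<^bsub>M\<^esub> (x \<oplus>\<^bsub>M\<^esub> y)"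
  using IM.a_rcos_sum[OF assms] by (simp add: quot_module_def)

lemma zero_quot_module: "\<zero>\<^bsub>V\<^esub> = IM +>\<^bsub>M\<^esub> \<zero>\<^bsub>M\<^esub>"
  using IM.a_rcos_const[OF IM.zero_closed] by (simp add: quot_module_def)

text \<open>
  The scalar multiple of a coset is a union over all representatives of both factors; it is a
  single coset because changing the representatives of \<open>a\<close> and \<open>x\<close> changes \<open>a \<odot> x\<close> by an element
  of \<open>I M\<close>.
\<close>

lemma smult_quot_module:
  assumes a: "a \<in> carrier R" and x: "x \<in> carrier M"
  shows "(I +> a) \<odot>\<^bsub>V\<^esub> (IM +>\<^bsub>M\<^esub> x) = IM +>\<^bsub>M\<^esub> (a \<odot>\<^bsub>M\<^esub> x)"
proof -
  have coset_eq: "IM +>\<^bsub>M\<^esub> (b \<odot>\<^bsub>M\<^esub> y) = IM +>\<^bsub>M\<^esub> (a \<odot>\<^bsub>M\<^esub> x)"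
    if b: "b \<in> I +> a" and y: "y \<in> IM +>\<^bsub>M\<^esub> x" for b y
  proof -
    obtain i where i: "i \<in> I" "b = i \<oplus> a"
      using b by (auto simp: a_r_coset_def')
    obtain h where h: "h \<in> IM" "y = h \<oplus>\<^bsub>M\<^esub> x"
      using y by (auto simp: a_r_coset_def')
    have carr: "i \<in> carrier R" "h \<in> carrier M"
      using i(1) h(1) IM.subset I.Icarr by auto
    have "b \<odot>\<^bsub>M\<^esub> y = (i \<odot>\<^bsub>M\<^esub> y \<oplus>\<^bsub>M\<^esub> a \<odot>\<^bsub>M\<^esub> h) \<oplus>\<^bsub>M\<^esub> a \<odot>\<^bsub>M\<^esub> x"
      using carr a x i(2) h(2) by (simp add: smult_l_distr smult_r_distr M.add.m_ac)
    moreover have "i \<odot>\<^bsub>M\<^esub> y \<oplus>\<^bsub>M\<^esub> a \<odot>\<^bsub>M\<^esub> h \<in> IM"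
      using i(1) h a x carr(2) by (intro IM.m_closed ideal_smult_mem IM.smult_closed) auto
    ultimately have "b \<odot>\<^bsub>M\<^esub> y \<in> IM +>\<^bsub>M\<^esub> (a \<odot>\<^bsub>M\<^esub> x)"
      by (auto simp: a_r_coset_def')
    then show ?thesis
      using a x by (intro IM.a_repr_independence'[symmetric]) auto
  qed
  have "a \<in> I +> a" "x \<in> IM +>\<^bsub>M\<^esub> x"
    using a x IM.a_rcos_self abelian_subgroup.a_rcos_self[OF abelian_subgroupI3[OF I.is_additive_subgroup R.is_abelian_group]]
    by auto
  then have "(\<Union>b\<in>I +> a. \<Union>y\<in>IM +>\<^bsub>M\<^esub> x. IM +>\<^bsub>M\<^esub> (b \<odot>\<^bsub>M\<^esub> y)) = IM +>\<^bsub>M\<^esub> (a \<odot>\<^bsub>M\<^esub> x)"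
    using coset_eq by blast
  then show ?thesis
    by (simp add: quot_module_def)
qed

lemma carrier_quot_ring: "carrier (R Quot I) = (\<lambda>a. I +> a) ` carrier R"
  by (auto simp: FactRing_def A_RCOSETS_def')

lemma module_quot_module: "Module.module (R Quot I) V"
proof (rule Module.moduleI)
  show "cring (R Quot I)"
    by (rule I.quotient_is_cring) (rule R.is_cring)
  have ring: "(I +> a) \<oplus>\<^bsub>R Quot I\<^esub> (I +> b) = I +> (a \<oplus> b)"
    "(I +> a) \<otimes>\<^bsub>R Quot I\<^esub> (I +> b) = I +> (a \<otimes> b)"
    if "a \<in> carrier R" "b \<in> carrier R" for a b
    using that by (simp_all add: ring_hom_add[OF I.rcos_ring_hom] ring_hom_mult[OF I.rcos_ring_hom])
  have one: "\<one>\<^bsub>R Quot I\<^esub> = I +> \<one>"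
    by (simp add: FactRing_def)
  note rules = carrier_quot_module carrier_quot_ring ring one add_quot_module smult_quot_module
  show "abelian_group V"
  proof (rule abelian_groupI)
    show "\<exists>y\<in>carrier V. y \<oplus>\<^bsub>V\<^esub> x = \<zero>\<^bsub>V\<^esub>" if x: "x \<in> carrier V" for x
    proof -
      obtain z where "z \<in> carrier M" "x = IM +>\<^bsub>M\<^esub> z"
        using x by (auto simp: carrier_quot_module)
      then show ?thesis
        by (intro bexI[of _ "IM +>\<^bsub>M\<^esub> (\<ominus>\<^bsub>M\<^esub> z)"])
          (simp_all add: carrier_quot_module add_quot_module zero_quot_module M.l_neg)
    qed
  qed (auto simp: carrier_quot_module add_quot_module zero_quot_module M.add.m_ac)
  show "a \<odot>\<^bsub>V\<^esub> x \<in> carrier V" if "a \<in> carrier (R Quot I)" "x \<in> carrier V" for a x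
    using that by (auto simp: rules)
  show "(a \<oplus>\<^bsub>R Quot I\<^esub> b) \<odot>\<^bsub>V\<^esub> x = a \<odot>\<^bsub>V\<^esub> x \<oplus>\<^bsub>V\<^esub> b \<odot>\<^bsub>V\<^esub> x"
    if "a \<in> carrier (R Quot I)" "b \<in> carrier (R Quot I)" "x \<in> carrier V" for a b x
    using that by (auto simp: rules smult_l_distr)
  show "a \<odot>\<^bsub>V\<^esub> (x \<oplus>\<^bsub>V\<^esub> y) = a \<odot>\<^bsub>V\<^esub> x \<oplus>\<^bsub>V\<^esub> a \<odot>\<^bsub>V\<^esub> y"
    if "a \<in> carrier (R Quot I)" "x \<in> carrier V" "y \<in> carrier V" for a x y
    using that by (auto simp: rules smult_r_distr)
  show "(a \<otimes>\<^bsub>R Quot I\<^esub> b) \<odot>\<^bsub>V\<^esub> x = a \<odot>\<^bsub>V\<^esub> (b \<odot>\<^bsub>V\<^esub> x)"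
    if "a \<in> carrier (R Quot I)" "b \<in> carrier (R Quot I)" "x \<in> carrier V" for a b x
    using that by (auto simp: rules smult_assoc1)
  show "\<one>\<^bsub>R Quot I\<^esub> \<odot>\<^bsub>V\<^esub> x = x" if "x \<in> carrier V" for x
    using that by (auto simp: rules)
qed

text \<open>
  Spans in the quotient are handled through the correspondence between submodules of the quotient
  and submodules of \<open>M\<close> that contain \<open>I M\<close>; this avoids computing with linear combinations of
  cosets.
\<close>

lemma submodule_quot_module_image:
  assumes "submodule R N M"
  shows "submodule (R Quot I) ((\<lambda>x. IM +>\<^bsub>M\<^esub> x) ` N) V"
proof -
  interpret N: submodule R N M by fact
  have N: "x \<in> carrier M" if "x \<in> N" for x
    using that N.subset by blast
  show ?thesis
  proof (rule submodule.intro[OF module_quot_module])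
    show "\<zero>\<^bsub>V\<^esub> \<in> (\<lambda>x. IM +>\<^bsub>M\<^esub> x) ` N"
      unfolding zero_quot_module using N.zero_closed by (rule imageI)
  qed (auto simp: N carrier_quot_module carrier_quot_ring add_quot_module smult_quot_module)
qed

lemma submodule_quot_module_vimage:
  assumes "submodule (R Quot I) U V"
  shows "submodule R {x \<in> carrier M. IM +>\<^bsub>M\<^esub> x \<in> U} M"
proof (rule submoduleI)
  interpret U: submodule "R Quot I" U V by fact
  show "\<zero>\<^bsub>M\<^esub> \<in> {x \<in> carrier M. IM +>\<^bsub>M\<^esub> x \<in> U}"
    using U.zero_closed by (simp add: zero_quot_module)
  show "x \<oplus>\<^bsub>M\<^esub> y \<in> {x \<in> carrier M. IM +>\<^bsub>M\<^esub> x \<in> U}"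
    if "x \<in> {x \<in> carrier M. IM +>\<^bsub>M\<^esub> x \<in> U}" "y \<in> {x \<in> carrier M. IM +>\<^bsub>M\<^esub> x \<in> U}" for x y
    using that U.m_closed by (simp flip: add_quot_module)
  show "a \<odot>\<^bsub>M\<^esub> x \<in> {x \<in> carrier M. IM +>\<^bsub>M\<^esub> x \<in> U}"
    if "a \<in> carrier R" "x \<in> {x \<in> carrier M. IM +>\<^bsub>M\<^esub> x \<in> U}" for a x
    using that U.smult_closed by (simp add: carrier_quot_ring flip: smult_quot_module)
qed blast

lemma coset_mem_image_iff:
  assumes "submodule R N M" and "IM \<subseteq> N" and "x \<in> carrier M"
  shows "IM +>\<^bsub>M\<^esub> x \<in> (\<lambda>x. IM +>\<^bsub>M\<^esub> x) ` N \<longleftrightarrow> x \<in> N"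
proof
  assume "IM +>\<^bsub>M\<^esub> x \<in> (\<lambda>x. IM +>\<^bsub>M\<^esub> x) ` N"
  then obtain y where y: "y \<in> N" "IM +>\<^bsub>M\<^esub> x = IM +>\<^bsub>M\<^esub> y"
    by blast
  then have "x \<in> IM +>\<^bsub>M\<^esub> y"
    using IM.a_rcos_self[OF assms(3)] by simp
  then obtain h where "h \<in> IM" "x = h \<oplus>\<^bsub>M\<^esub> y"
    by (auto simp: a_r_coset_def')
  then show "x \<in> N"
    using assms(2) y(1) submodule.m_closed[OF assms(1)] by auto
qed blast

end

text \<open>
  If a vanishing linear combination had a nonzero coefficient at \<open>v\<close>, then \<open>v\<close> would be a
  combination of the other elements of \<open>B\<close> and so would lie in the separating subspace \<open>W\<close>.
\<close>

lemma (in vectorspace) lin_indptI_separated: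
  assumes "B \<subseteq> carrier V"
    and "\<And>v. v \<in> B \<Longrightarrow> \<exists>W. submodule K W V \<and> B - {v} \<subseteq> W \<and> v \<notin> W"
  shows "lin_indpt B"
proof
  assume "lin_dep B"
  then obtain A a v where A: "finite A" "A \<subseteq> B" and a: "a \<in> A \<rightarrow> carrier K"
    and zero: "lincomb a A = \<zero>\<^bsub>V\<^esub>" and v: "v \<in> A" "a v \<noteq> \<zero>\<^bsub>K\<^esub>"
    unfolding lin_dep_def by blast
  obtain W where W: "submodule K W V" "B - {v} \<subseteq> W" "v \<notin> W"
    using assms(2) A(2) v(1) by blast
  have carr: "A \<subseteq> carrier V" "v \<in> carrier V" "a v \<in> carrier K"
    using assms(1) A(2) v(1) a by auto
  have "lincomb a (A - {v}) \<in> span (A - {v})"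
    using A(1) a unfolding span_def by blast
  also have "span (A - {v}) \<subseteq> W"
    using W(1,2) A(2) by (intro span_is_subset) auto
  finally have rest: "lincomb a (A - {v}) \<in> W" .
  have "lincomb a A = a v \<odot>\<^bsub>V\<^esub> v \<oplus>\<^bsub>V\<^esub> lincomb a (A - {v})"
    using A(1) carr(1) a v(1) by (rule lincomb_del2)
  then have "\<ominus>\<^bsub>V\<^esub> lincomb a (A - {v}) = a v \<odot>\<^bsub>V\<^esub> v"
    using zero carr rest submodule.subset[OF W(1)] by (intro M.minus_equality) auto
  moreover have "lincomb a (A - {v}) \<in> carrier V"
    using rest submodule.subset[OF W(1)] by blast
  ultimately have "\<zero>\<^bsub>V\<^esub> \<ominus>\<^bsub>V\<^esub> lincomb a (A - {v}) = a v \<odot>\<^bsub>V\<^esub> v"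
    using carr by (simp add: M.minus_eq)
  then have "a v \<odot>\<^bsub>V\<^esub> v \<in> W"
    using submodule_minus_closed[OF W(1) submodule.zero_closed[OF W(1)] rest] by simp
  moreover have "a v \<in> Units K"
    using v(2) carr(3) by (simp add: field.field_Units)
  ultimately show False
    using unit_smult_mem_submodule_iff[OF W(1) _ carr(2)] W(3) by blast
qed

section \<open>Generators with dual residue functionals\<close>

lemma ctwo_ordLeqI:
  assumes "x \<in> A" and "y \<in> A" and "x \<noteq> y"
  shows "ctwo \<le>o |A|"
  unfolding ctwo_def
  using assms by (intro card_of_ordLeqI[of "\<lambda>b. if b then x else y"]) (auto simp: inj_on_def)

lemma ctwo_ordLeqD:
  assumes "ctwo \<le>o |A|"
  obtains x y where "x \<in> A" and "y \<in> A" and "x \<noteq> y"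
proof -
  obtain h :: "bool \<Rightarrow> 'a" where "inj h" "range h \<subseteq> A"
    using assms by (auto simp: ctwo_def simp flip: card_of_ordLeq)
  then show ?thesis
    using that[of "h True" "h False"] by (auto dest: injD)
qed

text \<open>
  All that the argument uses of a direct sum of nonzero cyclic modules: generators \<open>e k\<close>, and a
  functional \<open>f k\<close> for each of them that reads off the residue of the coefficient of \<open>e k\<close>.
\<close>

locale residue_dual_system = local_module R M \<mm> for R (structure) and M (structure) and \<mm> +
  fixes K :: "'k set" and e :: "'k \<Rightarrow> 'c" and f :: "'k \<Rightarrow> 'c \<Rightarrow> 'a set"
  assumes e_closed: "k \<in> K \<Longrightarrow> e k \<in> carrier M"
    and functional: "k \<in> K \<Longrightarrow> residue_functional (f k)"
    and dual_eq: "k \<in> K \<Longrightarrow> f k (e k) = \<one>\<^bsub>F\<^esub>"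
    and dual_neq: "j \<in> K \<Longrightarrow> k \<in> K \<Longrightarrow> j \<noteq> k \<Longrightarrow> f j (e k) = \<zero>\<^bsub>F\<^esub>"
    and finite_support: "x \<in> carrier M \<Longrightarrow> finite {k \<in> K. f k x \<noteq> \<zero>\<^bsub>F\<^esub>}"
    and generating: "span (e ` K) = carrier M"
begin

lemma e_image: "e ` K \<subseteq> carrier M"
  using e_closed by blast

lemma proper_cover_residue_plus_one:
  assumes "ctwo \<le>o |K|"
  obtains C where "proper_cover R M C" and "|C| \<le>o |carrier F| +c cone"
proof -
  obtain j k where jk: "j \<in> K" "k \<in> K" "j \<noteq> k"
    using assms by (rule ctwo_ordLeqD)
  show ?thesis
  proof (rule proper_cover_by_lines)
    show "residue_functional (f j)" "residue_functional (f k)"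
      using jk functional by blast+
    show "e j \<in> carrier M" "e k \<in> carrier M"
      using jk e_closed by blast+
    show "f j (e j) \<noteq> \<zero>\<^bsub>F\<^esub>" "f k (e k) \<noteq> \<zero>\<^bsub>F\<^esub>" "f j (e k) = \<zero>\<^bsub>F\<^esub>"
      using jk by (simp_all add: dual_eq dual_neq)
  qed (rule that)
qed

lemma countable_proper_cover_infinite:
  assumes "infinite K"
  obtains C where "proper_cover R M C" and "|C| \<le>o |UNIV :: nat set|"
proof -
  obtain i :: "nat \<Rightarrow> 'k" where i: "inj i" "range i \<subseteq> K"
    using infinite_countable_subset[OF assms] by blast
  then have iK: "i n \<in> K" for n
    by blast
  show ?thesis
  proof (rule countable_proper_cover)
    show "residue_functional (f (i n))" for n
      using iK by (rule functional)
    show "\<exists>x\<in>carrier M. f (i n) x \<noteq> \<zero>\<^bsub>F\<^esub>" for n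
    proof
      show "f (i n) (e (i n)) \<noteq> \<zero>\<^bsub>F\<^esub>" "e (i n) \<in> carrier M"
        using e_closed[OF iK] dual_eq[OF iK] by simp_all
    qed
    show "finite {n. f (i n) x \<noteq> \<zero>\<^bsub>F\<^esub>}" if "x \<in> carrier M" for x
    proof (rule inj_on_finite)
      show "inj_on i {n. f (i n) x \<noteq> \<zero>\<^bsub>F\<^esub>}"
        using i(1) by (rule inj_on_subset) simp
      show "i ` {n. f (i n) x \<noteq> \<zero>\<^bsub>F\<^esub>} \<subseteq> {k \<in> K. f k x \<noteq> \<zero>\<^bsub>F\<^esub>}"
        using i(2) by blast
    qed (rule finite_support[OF that])
  qed (rule that)
qed

lemma residue_field_le_cover:
  assumes "finite K" and "proper_cover R M C"
  shows "|carrier F| \<le>o |C|"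
proof (rule ccontr)
  assume "\<not> |carrier F| \<le>o |C|"
  then have "|C| <o |carrier F|"
    by (simp add: not_ordLeq_iff_ordLess[OF card_of_Well_order card_of_Well_order])
  moreover have "\<not> e ` K \<subseteq> N" if "N \<in> C" for N
  proof
    assume "e ` K \<subseteq> N"
    moreover have N: "submodule R N M" "N \<noteq> carrier M"
      using assms(2) that by (auto simp: proper_cover_def)
    ultimately show False
      using span_is_subset[of "e ` K" N] generating submodule.subset[OF N(1)] by blast
  qed
  ultimately obtain v where "v \<in> span (e ` K)" "v \<notin> \<Union>C"
    using avoid_small_family[of "e ` K" C] assms e_image
    by (auto simp: proper_cover_def)
  then show False
    using assms(2) generating unfolding proper_cover_def by blast
qed

text \<open>
  For infinite \<open>C\<close> the summand \<open>1\<close> is absorbed, and \<open>|R / \<mm>| \<le> |C|\<close> is trivial when the residue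
  field is finite.
\<close>

lemma residue_plus_one_le_cover:
  assumes "finite (carrier F) \<or> finite K" and C: "proper_cover R M C"
  shows "|carrier F| +c cone \<le>o |C|"
proof (cases "finite C")
  case True
  with C show ?thesis
    by (rule finite_proper_cover_card)
next
  case False
  have le: "|carrier F| \<le>o |C|"
  proof (cases "finite K")
    case True
    then show ?thesis
      using C by (rule residue_field_le_cover)
  next
    case False
    then show ?thesis
      using assms(1) \<open>infinite C\<close> card_of_ordLeq_finite[of C "carrier F"]
        ordLeq_total[OF card_of_Well_order card_of_Well_order, of "carrier F" C] by blast
  qed
  have "|carrier F| +c cone =o |Sum_Type.Plus (carrier F) {()}|"
    unfolding cone_def by (rule ordIso_symmetric[OF Plus_csum])
  also have "|Sum_Type.Plus (carrier F) {()}| \<le>o |C|"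
  proof (rule card_of_Plus_ordLeq_infinite_Field)
    show "|{()}| \<le>o |C|"
      using False by (intro card_of_singl_ordLeq) auto
    show "infinite (Field |C| )"
      using False by (simp add: Field_card_of)
  qed (rule le card_of_Card_order)+
  finally show ?thesis .
qed

lemma infinite_cover:
  assumes "infinite (carrier F)" and "proper_cover R M C"
  shows "|UNIV :: nat set| \<le>o |C|"
proof -
  have "infinite C"
  proof
    assume "finite C"
    with assms(2) have "|carrier F| +c cone \<le>o |C|"
      by (rule finite_proper_cover_card)
    then have "|carrier F| \<le>o |C|"
      using ordLeq_csum1[OF card_of_Card_order] ordLeq_transitive by blast
    then show False
      using assms(1) \<open>finite C\<close> card_of_ordLeq_finite by blast
  qed
  then show ?thesis
    by (simp add: infinite_iff_card_of_nat)
qed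

sublocale quot: module_modulo_ideal R M \<mm>
  by unfold_locales

sublocale V: vectorspace F "quot_module M \<mm>"
  by (rule vectorspace.intro[OF quot.module_quot_module F.field_axioms])

text \<open>
  Each \<open>f k\<close> therefore factors through \<open>M / \<mm> M\<close>.
\<close>

lemma quot_zero_subset_kernel:
  assumes "k \<in> K"
  shows "ideal_smult M \<mm> \<subseteq> {x \<in> carrier M. f k x = \<zero>\<^bsub>F\<^esub>}"
proof (rule ideal_smult_subset_submodule)
  note f = functional[OF assms]
  show "submodule R {x \<in> carrier M. f k x = \<zero>\<^bsub>F\<^esub>} M"
    by (rule residue_functional_kernel[OF f])
  show "a \<odot>\<^bsub>M\<^esub> x \<in> {x \<in> carrier M. f k x = \<zero>\<^bsub>F\<^esub>}"
    if "a \<in> \<mm>" "x \<in> carrier M" for a x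
    using that residue_functional_closed[OF f that(2)] mm.Icarr[OF that(1)]
    by (simp add: residue_functional_smult[OF f] residue_of_mem)
qed

abbreviation coset_e where "coset_e k \<equiv> ideal_smult M \<mm> +>\<^bsub>M\<^esub> e k"

lemma coset_e_in_kernel_iff:
  assumes "j \<in> K" and "k \<in> K"
  shows "coset_e k \<in> (\<lambda>x. ideal_smult M \<mm> +>\<^bsub>M\<^esub> x) ` {x \<in> carrier M. f j x = \<zero>\<^bsub>F\<^esub>} \<longleftrightarrow> j \<noteq> k"
  using assms e_closed[OF assms(2)]
  by (subst quot.coset_mem_image_iff[OF residue_functional_kernel quot_zero_subset_kernel])
    (auto simp: functional dual_eq dual_neq)

lemma inj_on_coset_e: "inj_on coset_e K"
proof (rule inj_onI, rule ccontr)
  fix j k assume jk: "j \<in> K" "k \<in> K" "coset_e j = coset_e k" "j \<noteq> k"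
  then show False
    using coset_e_in_kernel_iff[OF jk(1,2)] coset_e_in_kernel_iff[OF jk(1,1)] by simp
qed

text \<open>
  The kernel of \<open>f k\<close> contains all generators but \<open>e k\<close>, so its image in the quotient separates
  the coset of \<open>e k\<close> from the other cosets.
\<close>

lemma basis_coset_e: "V.basis (coset_e ` K)"
  unfolding V.basis_def
proof (intro conjI)
  show carr: "coset_e ` K \<subseteq> carrier (quot_module M \<mm>)"
    using e_closed by (auto simp: quot.carrier_quot_module)
  show "V.lin_indpt (coset_e ` K)"
  proof (rule V.lin_indptI_separated[OF carr])
    fix v assume "v \<in> coset_e ` K"
    then obtain k where k: "k \<in> K" "v = coset_e k"
      by blast
    let ?W = "(\<lambda>x. ideal_smult M \<mm> +>\<^bsub>M\<^esub> x) ` {x \<in> carrier M. f k x = \<zero>\<^bsub>F\<^esub>}"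
    have "submodule F ?W (quot_module M \<mm>)"
      by (intro quot.submodule_quot_module_image residue_functional_kernel functional k)
    moreover have "coset_e ` K - {v} \<subseteq> ?W"
    proof
      fix w assume "w \<in> coset_e ` K - {v}"
      then obtain j where "j \<in> K" "w = coset_e j" "k \<noteq> j"
        using k(2) by blast
      then show "w \<in> ?W"
        using coset_e_in_kernel_iff[OF k(1)] by simp
    qed
    moreover have "v \<notin> ?W"
      using k coset_e_in_kernel_iff[OF k(1) k(1)] by simp
    ultimately show "\<exists>W. submodule F W (quot_module M \<mm>) \<and> coset_e ` K - {v} \<subseteq> W \<and> v \<notin> W"
      by blast
  qed
  let ?U = "{x \<in> carrier M. ideal_smult M \<mm> +>\<^bsub>M\<^esub> x \<in> V.span (coset_e ` K)}"
  have "e ` K \<subseteq> ?U"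
    using e_closed V.in_own_span[OF carr] by blast
  then have "span (e ` K) \<subseteq> ?U"
    by (rule span_is_subset) (intro quot.submodule_quot_module_vimage V.span_is_submodule carr)
  then show "V.span (coset_e ` K) = carrier (quot_module M \<mm>)"
    using V.span_is_subset2[OF carr] by (auto simp: generating quot.carrier_quot_module)
qed

text \<open>
  \<^const>\<open>vdim\<close> refers to an arbitrarily chosen basis. One with fewer than two elements would
  be a finite generating set smaller than an independent pair of cosets.
\<close>

lemma vdim_ge_two:
  assumes "ctwo \<le>o |K|"
  shows "ctwo \<le>o vdim F (quot_module M \<mm>)"
proof -
  define B where "B = (SOME B. V.basis B)"
  have B: "V.basis B"
    unfolding B_def using basis_coset_e by (rule someI)
  obtain j k where jk: "j \<in> K" "k \<in> K" "j \<noteq> k"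
    using assms by (rule ctwo_ordLeqD)
  let ?A = "{coset_e j, coset_e k}"
  have A: "card ?A = 2" "?A \<subseteq> coset_e ` K"
    using jk inj_on_eq_iff[OF inj_on_coset_e jk(1,2)] by simp_all
  have "\<exists>x\<in>B. \<exists>y\<in>B. x \<noteq> y"
  proof (rule ccontr)
    assume "\<not> (\<exists>x\<in>B. \<exists>y\<in>B. x \<noteq> y)"
    then obtain b where "B \<subseteq> {b}"
      by blast
    then have "finite B" "card B \<le> 1"
      using finite_subset card_mono[of "{b}" B] by auto
    moreover have "card ?A \<le> card B"
    proof (rule V.li_smaller_than_gen)
      note basis = basis_coset_e[unfolded V.basis_def] B[unfolded V.basis_def]
      show "V.lin_indpt ?A"
        by (rule V.subset_li_is_li[OF basis(1)[THEN conjunct1] A(2)])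
      show "?A \<subseteq> carrier (quot_module M \<mm>)"
        by (rule subset_trans[OF A(2)]) (simp only: basis)
      show "B \<subseteq> carrier (quot_module M \<mm>)" "V.gen_set B"
        by (simp_all only: basis)
    qed (use \<open>finite B\<close> in simp_all)
    ultimately show False
      using A(1) by simp
  qed
  then show ?thesis
    unfolding vdim_def B_def[symmetric] by (blast intro: ctwo_ordLeqI)
qed

text \<open>
  Hence the minimum that defines \<open>\<nu>'\<close> is over a single cardinal.
\<close>

lemma max_ideals_dim_ge2_eq:
  assumes "ctwo \<le>o |K|"
  shows "max_ideals_dim_ge2 R M = {\<mm>}"
proof (rule Set.set_eqI)
  fix \<nn>
  have "maximalideal \<nn> R \<longleftrightarrow> \<nn> = \<mm>"
    using local mm.is_maximalideal unfolding local_ring_def by fast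
  then show "\<nn> \<in> max_ideals_dim_ge2 R M \<longleftrightarrow> \<nn> \<in> {\<mm>}"
    unfolding max_ideals_dim_ge2_def mem_Collect_eq singleton_iff
    using vdim_ge_two[OF assms] by fast
qed

lemma nu'_ordIso:
  assumes "ctwo \<le>o |K|"
  shows "\<nu>' R M =o |carrier F| +c cone"
  unfolding nu'_def max_ideals_dim_ge2_eq[OF assms]
  by (rule min_card_ordIso[of "|carrier F| +c cone"]) (auto simp: Card_order_csum ordLeq_refl)

theorem covering_number_residue_dual_system:
  assumes "ctwo \<le>o |K|"
  shows "(\<exists>C. proper_cover R M C) \<and>
    (if infinite (carrier F) \<and> infinite K
     then \<sigma> R M =o |UNIV :: int set|
     else max_ideals_dim_ge2 R M \<noteq> {} \<and> \<sigma> R M =o \<nu>' R M \<and> \<nu>' R M =o |carrier F| +c cone)"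
proof (cases "infinite (carrier F) \<and> infinite K")
  case True
  then obtain C where C: "proper_cover R M C" "|C| \<le>o |UNIV :: nat set|"
    using countable_proper_cover_infinite by blast
  then have "\<sigma> R M =o |UNIV :: nat set|"
    using True infinite_cover by (intro covering_number_ordIso) auto
  also have "|UNIV :: nat set| =o |UNIV :: int set|"
    using bij_int_decode card_of_ordIso by blast
  finally show ?thesis
    using True C(1) by auto
next
  case False
  obtain C where C: "proper_cover R M C" "|C| \<le>o |carrier F| +c cone"
    using assms by (rule proper_cover_residue_plus_one)
  then have "\<sigma> R M =o |carrier F| +c cone"
    using False residue_plus_one_le_cover by (intro covering_number_ordIso) auto
  also have "|carrier F| +c cone =o \<nu>' R M"
    by (rule ordIso_symmetric[OF nu'_ordIso[OF assms]])
  finally show ?thesis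
    using False C(1) max_ideals_dim_ge2_eq[OF assms] nu'_ordIso[OF assms] by auto
qed

end

section \<open>Residue coordinates on a direct sum of cyclic modules\<close>

locale cyclic_direct_sum = local_module R M \<mm> for R (structure) and M (structure) and \<mm> +
  fixes K :: "'k set" and N :: "'k \<Rightarrow> 'c set"
  assumes direct_sum: "is_direct_sum R M K N"
    and cyclic: "k \<in> K \<Longrightarrow> cyclic_submodule R M (N k)"
    and nonzero: "k \<in> K \<Longrightarrow> N k \<noteq> {\<zero>\<^bsub>M\<^esub>}"
begin

abbreviation supp where "supp z \<equiv> {k \<in> K. z k \<noteq> \<zero>\<^bsub>M\<^esub>}"

definition families where "families = {z \<in> (\<Pi>\<^sub>E k\<in>K. N k). finite (supp z)}"

definition total where "total z = (\<Oplus>\<^bsub>M\<^esub>k\<in>supp z. z k)"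

definition coord where "coord = the_inv_into families total"

lemma submodule_N: "k \<in> K \<Longrightarrow> submodule R (N k) M"
  using direct_sum by (simp add: is_direct_sum_def)

lemma bij_total: "bij_betw total families (carrier M)"
  using direct_sum unfolding is_direct_sum_def families_def total_def[abs_def] by blast

lemma coord_mem: "x \<in> carrier M \<Longrightarrow> coord x \<in> families"
  and total_coord: "x \<in> carrier M \<Longrightarrow> total (coord x) = x"
  using bij_total f_the_inv_into_f_bij_betw[OF bij_total]
    bij_betwE[OF bij_betw_the_inv_into[OF bij_total]]
  by (auto simp: coord_def)

lemma coord_eqI: "z \<in> families \<Longrightarrow> total z = x \<Longrightarrow> coord x = z"
  using the_inv_into_f_f[OF bij_betw_imp_inj_on[OF bij_total]] by (auto simp: coord_def)

lemma families_closed: "z \<in> families \<Longrightarrow> k \<in> K \<Longrightarrow> z k \<in> N k"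
  and finite_supp: "z \<in> families \<Longrightarrow> finite (supp z)"
  by (auto simp: families_def)

lemma families_carrier: "z \<in> families \<Longrightarrow> k \<in> K \<Longrightarrow> z k \<in> carrier M"
  using families_closed submodule.subset[OF submodule_N] by blast

text \<open>
  Supports vary with the family, so families are added and scaled over a common finite index set.
\<close>

lemma total_eq:
  assumes "z \<in> families" and "finite A" and "supp z \<subseteq> A" and "A \<subseteq> K"
  shows "total z = (\<Oplus>\<^bsub>M\<^esub>k\<in>A. z k)"
  unfolding total_def
  using assms families_carrier[OF assms(1)]
  by (intro M.add.finprod_mono_neutral_cong_left) auto

lemma coord_add:
  assumes x: "x \<in> carrier M" and y: "y \<in> carrier M" and k: "k \<in> K"
  shows "coord (x \<oplus>\<^bsub>M\<^esub> y) k = coord x k \<oplus>\<^bsub>M\<^esub> coord y k"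
proof -
  define z where "z = (\<lambda>k\<in>K. coord x k \<oplus>\<^bsub>M\<^esub> coord y k)"
  note cx = coord_mem[OF x] and cy = coord_mem[OF y]
  define A where "A = supp (coord x) \<union> supp (coord y)"
  have A: "finite A" "A \<subseteq> K"
    using finite_supp[OF cx] finite_supp[OF cy] by (auto simp: A_def)
  have supp: "supp z \<subseteq> A"
    by (auto simp: z_def A_def)
  have z: "z \<in> families"
    unfolding families_def
  proof (intro CollectI conjI PiE_I)
    show "z k \<in> N k" if "k \<in> K" for k
      using that families_closed[OF cx that] families_closed[OF cy that]
        submodule.m_closed[OF submodule_N[OF that]] by (simp add: z_def)
    show "finite (supp z)"
      using A(1) supp by (rule rev_finite_subset)
  qed (simp add: z_def)
  have "total z = (\<Oplus>\<^bsub>M\<^esub>k\<in>A. z k)"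
    by (rule total_eq[OF z A(1) supp A(2)])
  also have "\<dots> = (\<Oplus>\<^bsub>M\<^esub>k\<in>A. coord x k \<oplus>\<^bsub>M\<^esub> coord y k)"
    using A(2) families_carrier[OF cx] families_carrier[OF cy]
    by (intro M.finsum_cong') (auto simp: z_def)
  also have "\<dots> = (\<Oplus>\<^bsub>M\<^esub>k\<in>A. coord x k) \<oplus>\<^bsub>M\<^esub> (\<Oplus>\<^bsub>M\<^esub>k\<in>A. coord y k)"
    using A(2) families_carrier[OF cx] families_carrier[OF cy] by (intro M.finsum_addf) auto
  also have "\<dots> = total (coord x) \<oplus>\<^bsub>M\<^esub> total (coord y)"
    using total_eq[OF cx A(1) _ A(2)] total_eq[OF cy A(1) _ A(2)] by (simp add: A_def)
  also have "\<dots> = x \<oplus>\<^bsub>M\<^esub> y"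
    using x y by (simp add: total_coord)
  finally have "coord (x \<oplus>\<^bsub>M\<^esub> y) = z"
    by (rule coord_eqI[OF z])
  then show ?thesis
    using k by (simp add: z_def)
qed

lemma coord_smult:
  assumes a: "a \<in> carrier R" and x: "x \<in> carrier M" and k: "k \<in> K"
  shows "coord (a \<odot>\<^bsub>M\<^esub> x) k = a \<odot>\<^bsub>M\<^esub> coord x k"
proof -
  define z where "z = (\<lambda>k\<in>K. a \<odot>\<^bsub>M\<^esub> coord x k)"
  note cx = coord_mem[OF x]
  define A where "A = supp (coord x)"
  have A: "finite A" "A \<subseteq> K"
    using finite_supp[OF cx] by (auto simp: A_def)
  have supp: "supp z \<subseteq> A"
    using a by (auto simp: z_def A_def)
  have z: "z \<in> families"
    unfolding families_def
  proof (intro CollectI conjI PiE_I)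
    show "z k \<in> N k" if "k \<in> K" for k
      using that families_closed[OF cx that] a
        submodule.smult_closed[OF submodule_N[OF that]] by (simp add: z_def)
    show "finite (supp z)"
      using A(1) supp by (rule rev_finite_subset)
  qed (simp add: z_def)
  have "total z = (\<Oplus>\<^bsub>M\<^esub>k\<in>A. z k)"
    by (rule total_eq[OF z A(1) supp A(2)])
  also have "\<dots> = (\<Oplus>\<^bsub>M\<^esub>k\<in>A. a \<odot>\<^bsub>M\<^esub> coord x k)"
    using A(2) a families_carrier[OF cx]
    by (intro M.finsum_cong') (auto simp: z_def)
  also have "\<dots> = a \<odot>\<^bsub>M\<^esub> (\<Oplus>\<^bsub>M\<^esub>k\<in>A. coord x k)"
    using A a families_carrier[OF cx] by (intro finsum_smult_ldistr[symmetric]) auto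
  also have "\<dots> = a \<odot>\<^bsub>M\<^esub> x"
    using total_eq[OF cx A(1) _ A(2)] x by (simp add: A_def total_coord)
  finally have "coord (a \<odot>\<^bsub>M\<^esub> x) = z"
    by (rule coord_eqI[OF z])
  then show ?thesis
    using k by (simp add: z_def)
qed

lemma coord_summand:
  assumes j: "j \<in> K" and x: "x \<in> N j" and k: "k \<in> K"
  shows "coord x k = (if k = j then x else \<zero>\<^bsub>M\<^esub>)"
proof -
  define z where "z = (\<lambda>k\<in>K. if k = j then x else \<zero>\<^bsub>M\<^esub>)"
  have xM: "x \<in> carrier M"
    using x submodule.subset[OF submodule_N[OF j]] by blast
  have supp: "supp z \<subseteq> {j}"
    by (auto simp: z_def)
  have z: "z \<in> families"
    unfolding families_def
  proof (intro CollectI conjI PiE_I)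
    show "z k \<in> N k" if "k \<in> K" for k
      using that x submodule.zero_closed[OF submodule_N[OF that]] by (simp add: z_def)
    show "finite (supp z)"
      using supp by (rule finite_subset) simp
  qed (simp add: z_def)
  have "total z = (\<Oplus>\<^bsub>M\<^esub>k\<in>{j}. z k)"
    using j by (intro total_eq[OF z _ supp]) auto
  also have "\<dots> = x"
    using j xM by (simp add: z_def)
  finally have "coord x = z"
    by (rule coord_eqI[OF z])
  then show ?thesis
    using k by (simp add: z_def)
qed

definition gen where "gen k = (SOME x. x \<in> carrier M \<and> N k = {a \<odot>\<^bsub>M\<^esub> x | a. a \<in> carrier R})"

lemma
  assumes "k \<in> K"
  shows gen_carrier: "gen k \<in> carrier M"
    and N_eq: "N k = {a \<odot>\<^bsub>M\<^esub> gen k | a. a \<in> carrier R}"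
proof -
  have "\<exists>x. x \<in> carrier M \<and> N k = {a \<odot>\<^bsub>M\<^esub> x | a. a \<in> carrier R}"
    using cyclic[OF assms] by (auto simp: cyclic_submodule_def)
  from someI_ex[OF this] show "gen k \<in> carrier M" "N k = {a \<odot>\<^bsub>M\<^esub> gen k | a. a \<in> carrier R}"
    by (simp_all flip: gen_def)
qed

lemma gen_mem: "k \<in> K \<Longrightarrow> gen k \<in> N k"
  using gen_carrier[of k] N_eq[of k] by (force intro: exI[of _ \<one>])

lemma gen_nonzero: "k \<in> K \<Longrightarrow> gen k \<noteq> \<zero>\<^bsub>M\<^esub>"
proof
  assume k: "k \<in> K" and "gen k = \<zero>\<^bsub>M\<^esub>"
  have "x = \<zero>\<^bsub>M\<^esub>" if x: "x \<in> N k" for x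
  proof -
    obtain a where "a \<in> carrier R" "x = a \<odot>\<^bsub>M\<^esub> gen k"
      using x N_eq[OF k] by blast
    then show ?thesis
      using \<open>gen k = \<zero>\<^bsub>M\<^esub>\<close> by simp
  qed
  then have "N k = {\<zero>\<^bsub>M\<^esub>}"
    using submodule.zero_closed[OF submodule_N[OF k]] by blast
  then show False
    using nonzero[OF k] by contradiction
qed

text \<open>
  The coefficient of \<open>gen k\<close> is determined only up to the annihilator of \<open>gen k\<close>. As
  \<open>gen k \<noteq> 0\<close>, no unit annihilates it, so the annihilator lies in \<open>\<mm>\<close> and the residue class does
  not depend on the choice.
\<close>

definition residue_coord where
  "residue_coord k x = \<mm> +> (SOME a. a \<in> carrier R \<and> coord x k = a \<odot>\<^bsub>M\<^esub> gen k)"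

lemma residue_coord_eqI:
  assumes k: "k \<in> K" and a: "a \<in> carrier R" "coord x k = a \<odot>\<^bsub>M\<^esub> gen k"
  shows "residue_coord k x = \<mm> +> a"
proof -
  define b where "b = (SOME a. a \<in> carrier R \<and> coord x k = a \<odot>\<^bsub>M\<^esub> gen k)"
  have b: "b \<in> carrier R" "coord x k = b \<odot>\<^bsub>M\<^esub> gen k"
    using someI[of "\<lambda>a. a \<in> carrier R \<and> coord x k = a \<odot>\<^bsub>M\<^esub> gen k" a] a by (auto simp: b_def)
  note gk = gen_carrier[OF k]
  have "\<mm> +> b = \<mm> +> a"
  proof (rule ccontr)
    assume "\<mm> +> b \<noteq> \<mm> +> a"
    then have unit: "b \<ominus> a \<in> Units R"
      by (rule residue_neq_imp_unit[OF b(1) a(1)])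
    have "(b \<ominus> a) \<odot>\<^bsub>M\<^esub> gen k = \<zero>\<^bsub>M\<^esub>"
      using a b gk by (simp add: R.minus_eq smult_l_distr smult_l_minus M.r_neg)
    moreover have "submodule R {\<zero>\<^bsub>M\<^esub>} M"
      by (rule submoduleI) auto
    ultimately show False
      using unit_smult_mem_submodule_iff[OF _ unit gk] gen_nonzero[OF k] by blast
  qed
  then show ?thesis
    by (simp add: residue_coord_def b_def)
qed

lemma coord_repr:
  assumes "k \<in> K" and "x \<in> carrier M"
  obtains a where "a \<in> carrier R" "coord x k = a \<odot>\<^bsub>M\<^esub> gen k" "residue_coord k x = \<mm> +> a"
proof -
  have "coord x k \<in> N k"
    using assms by (intro families_closed coord_mem)
  then obtain a where "a \<in> carrier R" "coord x k = a \<odot>\<^bsub>M\<^esub> gen k"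
    using N_eq[OF assms(1)] by blast
  then show ?thesis
    using that residue_coord_eqI[OF assms(1)] by blast
qed

lemma residue_functional_residue_coord:
  assumes k: "k \<in> K"
  shows "residue_functional (residue_coord k)"
  unfolding residue_functional_def
proof (intro conjI ballI Pi_I)
  note gk = gen_carrier[OF k]
  show "residue_coord k x \<in> carrier F" if x: "x \<in> carrier M" for x
  proof -
    obtain a where "a \<in> carrier R" "residue_coord k x = \<mm> +> a"
      by (rule coord_repr[OF k x])
    then show ?thesis
      using residue.hom_closed by simp
  qed
  show "residue_coord k (x \<oplus>\<^bsub>M\<^esub> y) = residue_coord k x \<oplus>\<^bsub>F\<^esub> residue_coord k y"
    if x: "x \<in> carrier M" and y: "y \<in> carrier M" for x y
  proof -
    obtain a where a: "a \<in> carrier R" "coord x k = a \<odot>\<^bsub>M\<^esub> gen k" "residue_coord k x = \<mm> +> a"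
      by (rule coord_repr[OF k x])
    obtain b where b: "b \<in> carrier R" "coord y k = b \<odot>\<^bsub>M\<^esub> gen k" "residue_coord k y = \<mm> +> b"
      by (rule coord_repr[OF k y])
    have "residue_coord k (x \<oplus>\<^bsub>M\<^esub> y) = \<mm> +> (a \<oplus> b)"
      using a b gk by (intro residue_coord_eqI[OF k]) (simp_all add: coord_add[OF x y k] smult_l_distr)
    then show ?thesis
      using residue.hom_add[OF a(1) b(1)] a(3) b(3) by simp
  qed
  show "residue_coord k (a \<odot>\<^bsub>M\<^esub> x) = (\<mm> +> a) \<otimes>\<^bsub>F\<^esub> residue_coord k x"
    if a: "a \<in> carrier R" and x: "x \<in> carrier M" for a x
  proof -
    obtain b where b: "b \<in> carrier R" "coord x k = b \<odot>\<^bsub>M\<^esub> gen k" "residue_coord k x = \<mm> +> b"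
      by (rule coord_repr[OF k x])
    have "residue_coord k (a \<odot>\<^bsub>M\<^esub> x) = \<mm> +> (a \<otimes> b)"
      using a b gk by (intro residue_coord_eqI[OF k]) (simp_all add: coord_smult[OF a x k] smult_assoc1)
    then show ?thesis
      using residue.hom_mult[OF a b(1)] b(3) by simp
  qed
qed

lemma residue_coord_eq_zero:
  assumes k: "k \<in> K" and "coord x k = \<zero>\<^bsub>M\<^esub>"
  shows "residue_coord k x = \<zero>\<^bsub>F\<^esub>"
proof -
  have "residue_coord k x = \<mm> +> \<zero>"
    using assms gen_carrier[OF k] by (intro residue_coord_eqI) auto
  then show ?thesis
    using residue_of_mem[of \<zero>] by simp
qed

lemma span_gen: "span (gen ` K) = carrier M"
proof
  have gens: "gen ` K \<subseteq> carrier M"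
    using gen_carrier by blast
  then show "span (gen ` K) \<subseteq> carrier M"
    by (rule span_is_subset2)
  interpret S: submodule R "span (gen ` K)" M
    using gens by (rule span_is_submodule)
  have N: "N k \<subseteq> span (gen ` K)" if "k \<in> K" for k
    using N_eq[OF that] in_own_span[OF gens] that by auto
  show "carrier M \<subseteq> span (gen ` K)"
  proof
    fix x assume x: "x \<in> carrier M"
    have "total (coord x) \<in> span (gen ` K)"
      unfolding total_def
      using N families_closed[OF coord_mem[OF x]]
      by (intro submodule_finsum_closed[OF S.submodule_axioms]) blast
    then show "x \<in> span (gen ` K)"
      by (simp add: total_coord[OF x])
  qed
qed

sublocale dual: residue_dual_system R M \<mm> K gen residue_coord
proof
  show "gen k \<in> carrier M" "residue_functional (residue_coord k)" if "k \<in> K" for k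
    using that by (rule gen_carrier residue_functional_residue_coord)+
  show "residue_coord k (gen k) = \<one>\<^bsub>F\<^esub>" if "k \<in> K" for k
  proof -
    have "residue_coord k (gen k) = \<mm> +> \<one>"
      using that gen_carrier[OF that]
      by (intro residue_coord_eqI)
        (simp_all add: coord_summand[OF that gen_mem])
    then show ?thesis
      using residue.hom_one by simp
  qed
  show "residue_coord j (gen k) = \<zero>\<^bsub>F\<^esub>" if "j \<in> K" "k \<in> K" "j \<noteq> k" for j k
    using that by (intro residue_coord_eq_zero) (simp_all add: coord_summand[OF _ gen_mem])
  show "finite {k \<in> K. residue_coord k x \<noteq> \<zero>\<^bsub>F\<^esub>}" if x: "x \<in> carrier M" for x
    using finite_supp[OF coord_mem[OF x]] by (rule rev_finite_subset)
      (use residue_coord_eq_zero in blast)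
qed (rule span_gen)

end

section \<open>The covering number\<close>

theorem corollary3p5:
  fixes R :: "('a, 'r) ring_scheme" and M :: "('a, 'b, 'm) module_scheme"
    and \<mm> :: "'a set" and K :: "'k set" and N :: "'k \<Rightarrow> 'b set"
  assumes "local_ring R \<mm>"
    and "module R M"
    and "is_direct_sum R M K N"
    and "\<And>k. k \<in> K \<Longrightarrow> cyclic_submodule R M (N k)"
    and "\<And>k. k \<in> K \<Longrightarrow> N k \<noteq> {\<zero>\<^bsub>M\<^esub>}"
    and "ctwo \<le>o |K|"
  shows "(\<exists>C. proper_cover R M C) \<and>
    (if infinite (carrier (R Quot \<mm>)) \<and> infinite K
     then \<sigma> R M =o |UNIV :: int set|
     else max_ideals_dim_ge2 R M \<noteq> {} \<and>
          \<sigma> R M =o \<nu>' R M \<and>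
          \<nu>' R M =o |carrier (R Quot \<mm>)| +c cone)"
proof -
  interpret cyclic_direct_sum R M \<mm> K N
    using assms by (intro cyclic_direct_sum.intro local_module.intro local_module_axioms.intro
        cyclic_direct_sum_axioms.intro)
  show ?thesis
    using assms(6) by (rule dual.covering_number_residue_dual_system)
qed

end
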